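(* Let $\mathcal{P}=\{P_{\theta,G}:\theta\in\Theta,\ G\in\mathcal{G}\}$, with $\Theta\subset\mathbb{R}^k$ open, be a regular semiparametric model. Let $N\subset\mathbb{R}^d$ be open, $d<k$, let $f:N\to\mathbb{R}^k$ be continuously differentiable with $f(N)\subset\Theta$ and with $k\times d$ Jacobian matrix $\dot f(\nu)=(\partial f_i(\nu)/\partial\nu_j)_{i=1,\dots,k;\,j=1,\dots,d}$ of full rank for every $\nu\in N$, and let $\mathcal{Q}=\{P_{f(\nu),G}:\nu\in N,\ G\in\mathcal{G}\}\subset\mathcal{P}$ be a regular semiparametric submodel. Fix $\nu_0\in N$, $\theta_0=f(\nu_0)$ and $G_0\in\mathcal{G}$. If there exists a regular parametric submodel $\mathcal{P}_\psi=\{P_{\theta,\psi(\theta)}:\theta\in\Theta\}$ of $\mathcal{P}$, where $\psi:\Theta\to\mathcal{G}$ and $\psi(\theta_0)=G_0$, with score function $\dot\ell(\theta_0,\mathcal{P}_\psi)$ for $\theta$ at $\theta_0$, then there exists a regular parametric submodel of $\mathcal{Q}$, namely $$\mathcal{Q}_\psi=\{P_{f(\nu),\psi(f(\nu))}:\nu\in N\},$$ with score function $\dot\ell(\nu_0,\mathcal{Q}_\psi)$ for $\nu$ at $\nu_0$ satisfying $$\dot\ell(\nu_0,\mathcal{Q}_\psi)=\dot f^T(\nu_0)\,\dot\ell(\theta_0,\mathcal{P}_\psi).$$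
   Context: All distributions live on a measurable space $(\mathcal{X},\mathcal{A})$; $\mathcal{G}$ is an arbitrary (nuisance) parameter set, possibly finite dimensional or degenerate. Regular parametric model: $\mathcal{P}_\Theta=\{P_\theta:\theta\in\Theta\}$, $\Theta$ an open subset of a Euclidean space $\mathbb{R}^k$, all $P_\theta$ dominated by a $\sigma$-finite measure $\mu$ with densities $p(\theta)$, such that (i) for each $\theta_0\in\Theta$ there is a $k$-vector $\dot\ell(\theta_0,\mathcal{P}_\Theta)$ of elements of $L_2(P_{\theta_0})$ (the score function at $\theta_0$) with $\|\sqrt{p(\theta)}-\sqrt{p(\theta_0)}-\frac12(\theta-\theta_0)^T\dot\ell(\theta_0,\mathcal{P}_\Theta)\sqrt{p(\theta_0)}\|_{L_2(\mu)}=o(|\theta-\theta_0|)$ as $\theta\to\theta_0$; (ii) the Fisher information matrix $\int\dot\ell(\theta_0,\mathcal{P}_\Theta)\dot\ell^T(\theta_0,\mathcal{P}_\Theta)dP_{\theta_0}$ is nonsingular; (iii) the map $\theta\mapsto\dot\ell(\theta,\mathcal{P}_\Theta)\sqrt{p(\theta)}$ from $\Theta$ to $L_2^k(\mu)$ is continuous. Regular semiparametric model: $\mathcal{P}=\{P_{\theta,G}\}$ such that for every $G\in\mathcal{G}$ the model $\{P_{\theta,G}:\theta\in\Theta\}$ is a regular parametric model (and similarly for $\mathcal{Q}$ with parameter $\nu\in N$). *)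

theory Defs
  imports "HOL-Analysis.Analysis" "HOL-Probability.Probability" "HOL-Library.Landau_Symbols"
begin

definition in_L2 :: "'a measure \<Rightarrow> ('a \<Rightarrow> real^'n) \<Rightarrow> bool" where
  "in_L2 M g \<longleftrightarrow> g \<in> borel_measurable M \<and> integrable M (\<lambda>x. (norm (g x))\<^sup>2)"

text \<open>
  The Bochner integral of a non-integrable function is 0, so the following is the norm only
  for square-integrable functions. It is applied below only to combinations of \<open>sqrt p(\<theta>)\<close>, where
  \<open>p(\<theta>)\<close> is a probability density, and of \<open>score * sqrt p(\<theta>)\<close>, where the score is in \<open>L2(P(\<theta>))\<close>;
  all of these are in \<open>L2(\<mu>)\<close>.
\<close>

definition L2_norm :: "'a measure \<Rightarrow> ('a \<Rightarrow> 'b::euclidean_space) \<Rightarrow> real" where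
  "L2_norm M g = sqrt (\<integral>x. (norm (g x))\<^sup>2 \<partial>M)"

text \<open>
  A model on the measurable space underlying \<open>M\<close> (only \<open>sets M\<close> matters) is a parameter set
  \<open>\<Theta>\<close> with a family \<open>P\<close>, whose values outside \<open>\<Theta>\<close> are irrelevant.
\<close>

definition has_densities ::
  "'a measure \<Rightarrow> (real^'n) set \<Rightarrow> (real^'n \<Rightarrow> 'a measure) \<Rightarrow> 'a measure \<Rightarrow> (real^'n \<Rightarrow> 'a \<Rightarrow> real) \<Rightarrow> bool"
  where
  "has_densities M \<Theta> P \<mu> p \<longleftrightarrow>
     sigma_finite_measure \<mu> \<and> sets \<mu> = sets M \<and>
     (\<forall>\<theta>\<in>\<Theta>. prob_space (P \<theta>) \<and> p \<theta> \<in> borel_measurable \<mu> \<and> (\<forall>x\<in>space \<mu>. 0 \<le> p \<theta> x) \<and>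
        P \<theta> = density \<mu> (\<lambda>x. ennreal (p \<theta> x)))"

definition score_wrt ::
  "(real^'n) set \<Rightarrow> (real^'n \<Rightarrow> 'a measure) \<Rightarrow> 'a measure \<Rightarrow> (real^'n \<Rightarrow> 'a \<Rightarrow> real) \<Rightarrow>
     real^'n \<Rightarrow> ('a \<Rightarrow> real^'n) \<Rightarrow> bool"
  where
  "score_wrt \<Theta> P \<mu> p \<theta>0 sc \<longleftrightarrow>
     in_L2 (P \<theta>0) sc \<and>
     (\<lambda>\<theta>. L2_norm \<mu> (\<lambda>x. sqrt (p \<theta> x) - sqrt (p \<theta>0 x)
                          - 1 / 2 * ((\<theta> - \<theta>0) \<bullet> sc x) * sqrt (p \<theta>0 x)))
       \<in> o[at \<theta>0 within \<Theta>](\<lambda>\<theta>. norm (\<theta> - \<theta>0))"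

text \<open>
  Scores are elements of \<open>L2(P(\<theta>0))\<close>, represented here by functions, so a score function is
  determined only \<open>P(\<theta>0)\<close>-almost everywhere. Whether \<open>sc\<close> is a score function does not depend on
  the choice of the dominating measure and of the versions of the densities.
\<close>

definition score_function ::
  "'a measure \<Rightarrow> (real^'n) set \<Rightarrow> (real^'n \<Rightarrow> 'a measure) \<Rightarrow> real^'n \<Rightarrow> ('a \<Rightarrow> real^'n) \<Rightarrow> bool"
  where
  "score_function M \<Theta> P \<theta>0 sc \<longleftrightarrow> (\<exists>\<mu> p. has_densities M \<Theta> P \<mu> p \<and> score_wrt \<Theta> P \<mu> p \<theta>0 sc)"

definition fisher_information :: "'a measure \<Rightarrow> ('a \<Rightarrow> real^'n) \<Rightarrow> real^'n^'n" where
  "fisher_information M sc = (\<chi> i j. \<integral>x. sc x $ i * sc x $ j \<partial>M)"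

definition regular_parametric_model ::
  "'a measure \<Rightarrow> (real^'n) set \<Rightarrow> (real^'n \<Rightarrow> 'a measure) \<Rightarrow> bool"
  where
  "regular_parametric_model M \<Theta> P \<longleftrightarrow>
     open \<Theta> \<and>
     (\<exists>\<mu> p sc. has_densities M \<Theta> P \<mu> p \<and>
        (\<forall>\<theta>0\<in>\<Theta>. score_wrt \<Theta> P \<mu> p \<theta>0 (sc \<theta>0)) \<and>
        (\<forall>\<theta>0\<in>\<Theta>. invertible (fisher_information (P \<theta>0) (sc \<theta>0))) \<and>
        (\<forall>\<theta>0\<in>\<Theta>. ((\<lambda>\<theta>. L2_norm \<mu> (\<lambda>x. sqrt (p \<theta> x) *\<^sub>R sc \<theta> x - sqrt (p \<theta>0 x) *\<^sub>R sc \<theta>0 x))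
                   \<longlongrightarrow> 0) (at \<theta>0 within \<Theta>)))"

text \<open>The dominating measure may depend on the nuisance parameter.\<close>

definition regular_semiparametric_model ::
  "'a measure \<Rightarrow> (real^'n) set \<Rightarrow> 'g set \<Rightarrow> (real^'n \<Rightarrow> 'g \<Rightarrow> 'a measure) \<Rightarrow> bool"
  where
  "regular_semiparametric_model M \<Theta> \<G> P \<longleftrightarrow>
     (\<forall>G\<in>\<G>. regular_parametric_model M \<Theta> (\<lambda>\<theta>. P \<theta> G))"

definition regular_parametric_submodel ::
  "'a measure \<Rightarrow> (real^'n) set \<Rightarrow> 'g set \<Rightarrow> (real^'n \<Rightarrow> 'g \<Rightarrow> 'a measure) \<Rightarrow> (real^'n \<Rightarrow> 'g) \<Rightarrow> bool"
  where
  "regular_parametric_submodel M \<Theta> \<G> P \<psi> \<longleftrightarrow>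
     \<psi> ` \<Theta> \<subseteq> \<G> \<and> regular_parametric_model M \<Theta> (\<lambda>\<theta>. P \<theta> (\<psi> \<theta>))"

end

theory Submission
  imports Defs
begin

text \<open>
  Composing the expansion of \<open>sqrt p\<close> at \<open>\<theta>0\<close> with the first-order expansion of \<open>f\<close> at \<open>\<nu>0\<close> gives
  differentiability in quadratic mean with score \<open>J\<^sup>T s\<close>. The Fisher information is nonsingular iff
  no nonzero linear combination of the score components vanishes almost everywhere, and this
  passes from \<open>s\<close> to \<open>J\<^sup>T s\<close> because \<open>J\<close> is injective. Scores are compared across dominating
  measures through the ratios \<open>p \<theta> / p \<theta>0\<close>, which are intrinsic \<open>P \<theta>0\<close>-almost everywhere: two
  scores then satisfy \<open>h \<bullet> (s1 - s2) = o(norm h)\<close> in \<open>L2(P \<theta>0)\<close>, and homogeneity in \<open>h\<close> forces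
  \<open>s1 = s2\<close> almost everywhere.
\<close>

section \<open>Square integrability and estimates for the \<open>L2\<close> norm\<close>

text \<open>The codomain is any Euclidean space, because real-valued remainders and square roots of
  densities are needed besides vector-valued scores; \<open>in_L2\<close> covers only the
  latter.\<close>

definition square_integrable :: "'a measure \<Rightarrow> ('a \<Rightarrow> 'b::euclidean_space) \<Rightarrow> bool" where
  "square_integrable M g \<longleftrightarrow> g \<in> borel_measurable M \<and> integrable M (\<lambda>x. (norm (g x))\<^sup>2)"

lemma in_L2_iff: "in_L2 M g \<longleftrightarrow> square_integrable M g"
  by (simp add: in_L2_def square_integrable_def)

lemma power2_le_two_squares:
  fixes t u v :: real
  assumes "0 \<le> t" "t \<le> u + v"
  shows "t\<^sup>2 \<le> 2 * u\<^sup>2 + 2 * v\<^sup>2"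
proof -
  have "t\<^sup>2 \<le> (u + v)\<^sup>2"
    using assms by (simp add: power_mono)
  also have "\<dots> \<le> 2 * u\<^sup>2 + 2 * v\<^sup>2"
    using sum_squares_bound[of u v] by (simp add: power2_sum)
  finally show ?thesis .
qed

lemma square_integrable_bound:
  assumes u: "square_integrable M u" and v: "square_integrable M v"
    and g: "g \<in> borel_measurable M"
    and le: "\<And>x. x \<in> space M \<Longrightarrow> norm (g x) \<le> a * norm (u x) + b * norm (v x)"
  shows "square_integrable M g"
  unfolding square_integrable_def
proof
  show "integrable M (\<lambda>x. (norm (g x))\<^sup>2)"
  proof (rule Bochner_Integration.integrable_bound)
    show "integrable M (\<lambda>x. 2 * (a * norm (u x))\<^sup>2 + 2 * (b * norm (v x))\<^sup>2)"
      using u v by (auto simp: square_integrable_def power_mult_distrib)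
    show "AE x in M. norm ((norm (g x))\<^sup>2) \<le> norm (2 * (a * norm (u x))\<^sup>2 + 2 * (b * norm (v x))\<^sup>2)"
      using le by (auto intro!: AE_I2 power2_le_two_squares)
  qed (use g in measurable)
qed (rule g)

lemma L2_norm_nonneg: "0 \<le> L2_norm M g"
  by (simp add: L2_norm_def)

lemma L2_norm_zero [simp]: "L2_norm M (\<lambda>x. 0) = 0"
  by (simp add: L2_norm_def)

text \<open>A crude substitute for Minkowski's inequality: (s + t)^2 \<le> 2 s^2 + 2 t^2 holds
  pointwise, and the price is the factor 2. Such constants are harmless, since the estimate only
  ever feeds limits and little-o statements.\<close>

lemma L2_norm_le:
  assumes u: "square_integrable M u" and v: "square_integrable M v"
    and le: "\<And>x. x \<in> space M \<Longrightarrow> norm (g x) \<le> a * norm (u x) + b * norm (v x)"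
    and ab: "0 \<le> a" "0 \<le> b"
  shows "L2_norm M g \<le> 2 * (a * L2_norm M u + b * L2_norm M v)"
proof -
  let ?U = "L2_norm M u" and ?V = "L2_norm M v"
  \<comment> \<open>Only the dominating function has to be integrable here: if the left integrand is
    not, its integral is 0 by default and the bound still holds.\<close>
  have "(\<integral>x. (norm (g x))\<^sup>2 \<partial>M) \<le> (\<integral>x. 2 * (a * norm (u x))\<^sup>2 + 2 * (b * norm (v x))\<^sup>2 \<partial>M)"
    using u v le by (intro integral_mono' power2_le_two_squares)
      (auto simp: square_integrable_def power_mult_distrib)
  also have "\<dots> = 2 * (a * ?U)\<^sup>2 + 2 * (b * ?V)\<^sup>2"
    using u v by (simp add: square_integrable_def power_mult_distrib L2_norm_def)
  also have "\<dots> \<le> (2 * (a * ?U + b * ?V))\<^sup>2"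
    using ab L2_norm_nonneg[of M u] L2_norm_nonneg[of M v]
    by (simp add: power2_eq_square algebra_simps)
  finally show ?thesis
    unfolding L2_norm_def[of M g] using ab
    by (intro real_le_lsqrt) (auto intro!: integral_nonneg add_nonneg_nonneg mult_nonneg_nonneg L2_norm_nonneg)
qed

section \<open>Passing between \<open>L2(P \<theta>)\<close> and \<open>L2(\<mu>)\<close>\<close>

lemma has_densitiesD:
  assumes "has_densities M \<Theta> P \<mu> p" "\<theta> \<in> \<Theta>"
  shows "p \<theta> \<in> borel_measurable \<mu>"
    and "\<And>x. x \<in> space \<mu> \<Longrightarrow> 0 \<le> p \<theta> x"
    and "P \<theta> = density \<mu> (\<lambda>x. ennreal (p \<theta> x))"
    and "prob_space (P \<theta>)"
    and "sets (P \<theta>) = sets M"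
    and "sets \<mu> = sets M"
    and "space (P \<theta>) = space \<mu>"
    and "borel_measurable (P \<theta>) = (borel_measurable \<mu> :: ('a \<Rightarrow> 'b::topological_space) set)"
  using assms by (auto simp: has_densities_def)

lemma square_integrable_sqrt_density:
  assumes d: "has_densities M \<Theta> P \<mu> p" "\<theta> \<in> \<Theta>"
  shows "square_integrable \<mu> (\<lambda>x. sqrt (p \<theta> x))"
proof -
  note [measurable] = has_densitiesD(1)[OF d]
  interpret prob_space "P \<theta>" by (rule has_densitiesD(4)[OF d])
  \<comment> \<open>Integrability of the constant 1 under the probability \<open>P \<theta>\<close>
    is integrability of \<open>p \<theta>\<close> under \<mu>, and \<open>p \<theta>\<close> is the
    square of its root.\<close>
  have "integrable (P \<theta>) (\<lambda>x. 1 :: real)" by simp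
  then have "integrable \<mu> (p \<theta>)"
    unfolding has_densitiesD(3)[OF d]
    by (subst (asm) integrable_density) (auto intro!: AE_I2 has_densitiesD(2)[OF d])
  then have "integrable \<mu> (\<lambda>x. (norm (sqrt (p \<theta> x)))\<^sup>2)"
    by (rule Bochner_Integration.integrable_cong[THEN iffD1, rotated -1])
       (auto simp: has_densitiesD(2)[OF d])
  then show ?thesis
    by (simp add: square_integrable_def)
qed

text \<open>Multiplication by \<open>sqrt (p \<theta>)\<close> is an isometry from
  \<open>L2(P \<theta>)\<close> into \<open>L2(\<mu>)\<close>, as the squared factor is exactly the
  density. Membership is treated here, the norm in \<open>L2_norm_density\<close>.\<close>

lemma square_integrable_density_iff:
  fixes s :: "'a \<Rightarrow> 'b::euclidean_space"
  assumes d: "has_densities M \<Theta> P \<mu> p" "\<theta> \<in> \<Theta>" and s: "s \<in> borel_measurable \<mu>"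
  shows "square_integrable (P \<theta>) s \<longleftrightarrow> square_integrable \<mu> (\<lambda>x. sqrt (p \<theta> x) *\<^sub>R s x)"
proof -
  note [measurable] = has_densitiesD(1)[OF d] s
  have "integrable (P \<theta>) (\<lambda>x. (norm (s x))\<^sup>2) \<longleftrightarrow> integrable \<mu> (\<lambda>x. p \<theta> x * (norm (s x))\<^sup>2)"
    unfolding has_densitiesD(3)[OF d]
    by (subst integrable_density) (auto intro!: AE_I2 has_densitiesD(2)[OF d])
  also have "\<dots> \<longleftrightarrow> integrable \<mu> (\<lambda>x. (norm (sqrt (p \<theta> x) *\<^sub>R s x))\<^sup>2)"
    by (rule Bochner_Integration.integrable_cong)
       (auto simp: has_densitiesD(2)[OF d] power_mult_distrib)
  finally show ?thesis
    using s by (simp add: square_integrable_def has_densitiesD(8)[OF d])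
qed

lemma L2_norm_density:
  fixes s :: "'a \<Rightarrow> 'b::euclidean_space"
  assumes d: "has_densities M \<Theta> P \<mu> p" "\<theta> \<in> \<Theta>" and s: "s \<in> borel_measurable \<mu>"
  shows "L2_norm (P \<theta>) s = L2_norm \<mu> (\<lambda>x. sqrt (p \<theta> x) *\<^sub>R s x)"
proof -
  note [measurable] = has_densitiesD(1)[OF d] s
  have "(\<integral>x. (norm (s x))\<^sup>2 \<partial>P \<theta>) = (\<integral>x. p \<theta> x * (norm (s x))\<^sup>2 \<partial>\<mu>)"
    unfolding has_densitiesD(3)[OF d]
    by (subst integral_density) (auto intro!: AE_I2 has_densitiesD(2)[OF d])
  also have "\<dots> = (\<integral>x. (norm (sqrt (p \<theta> x) *\<^sub>R s x))\<^sup>2 \<partial>\<mu>)"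
    by (rule Bochner_Integration.integral_cong)
       (auto simp: has_densitiesD(2)[OF d] power_mult_distrib)
  finally show ?thesis
    by (simp add: L2_norm_def)
qed

lemma norm_half_inner_mult_le:
  fixes q :: real
  assumes "0 \<le> q"
  shows "norm (1 / 2 * (h \<bullet> y) * q) \<le> norm h * norm (q *\<^sub>R y)"
proof -
  have "norm (1 / 2 * (h \<bullet> y) * q) \<le> \<bar>h \<bullet> y\<bar> * q"
    using assms by (simp add: abs_mult)
  also have "\<dots> \<le> (norm h * norm y) * q"
    using assms by (intro mult_right_mono Cauchy_Schwarz_ineq2)
  finally show ?thesis
    using assms by (simp add: mult_ac)
qed

text \<open>\<open>L2_norm\<close> behaves as a norm only on square-integrable functions, so this
  precedes every estimate of a remainder. The increment \<open>h\<close> is left free and need not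
  be \<open>\<theta> - \<theta>0\<close>.\<close>

lemma square_integrable_remainder:
  assumes d: "has_densities M \<Theta> P \<mu> p" and th: "\<theta> \<in> \<Theta>" "\<theta>0 \<in> \<Theta>"
    and sc: "in_L2 (P \<theta>0) sc"
  shows "square_integrable \<mu> (\<lambda>x. sqrt (p \<theta> x) - sqrt (p \<theta>0 x) - 1 / 2 * (h \<bullet> sc x) * sqrt (p \<theta>0 x))"
proof -
  note [measurable] = has_densitiesD(1)[OF d th(1)] has_densitiesD(1)[OF d th(2)]
  have scm [measurable]: "sc \<in> borel_measurable \<mu>"
    using sc by (simp add: in_L2_def has_densitiesD(8)[OF d th(2)])
  have s: "square_integrable \<mu> (\<lambda>x. sqrt (p \<theta>0 x) *\<^sub>R sc x)"
    using sc square_integrable_density_iff[OF d th(2) scm] by (simp add: in_L2_iff)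
  have r: "square_integrable \<mu> (\<lambda>x. sqrt (p \<theta> x) - sqrt (p \<theta>0 x))"
    by (rule square_integrable_bound[OF square_integrable_sqrt_density[OF d th(1)]
          square_integrable_sqrt_density[OF d th(2)], of _ 1 1]) (auto intro: norm_triangle_ineq4[THEN order_trans])
  show ?thesis
  proof (rule square_integrable_bound[OF r s, of _ 1 "norm h"])
    fix x assume x: "x \<in> space \<mu>"
    have "norm (1 / 2 * (h \<bullet> sc x) * sqrt (p \<theta>0 x)) \<le> norm h * norm (sqrt (p \<theta>0 x) *\<^sub>R sc x)"
      using has_densitiesD(2)[OF d th(2) x] by (intro norm_half_inner_mult_le) simp
    then show "norm (sqrt (p \<theta> x) - sqrt (p \<theta>0 x) - 1 / 2 * (h \<bullet> sc x) * sqrt (p \<theta>0 x))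
      \<le> 1 * norm (sqrt (p \<theta> x) - sqrt (p \<theta>0 x)) + norm h * norm (sqrt (p \<theta>0 x) *\<^sub>R sc x)"
      by (intro order_trans[OF norm_triangle_ineq4]) auto
  qed measurable
qed

section \<open>Chain rule for scores\<close>

text \<open>Prepares composition with a map that may take the value \<open>a\<close> away from its
  base point: the punctured filter would then be too small a target. Including \<open>a\<close>
  costs nothing, because \<open>D a = 0\<close> satisfies every little-o inequality there.\<close>

lemma smallo_at_within_extend:
  fixes D :: "'a::topological_space \<Rightarrow> real"
  assumes D: "D \<in> o[at a within S](g)" and "D a = 0"
  shows "D \<in> o[inf (nhds a) (principal S)](g)"
proof (rule landau_o.smallI)
  fix c :: real assume c: "c > 0"
  from landau_o.smallD[OF D c]
  show "\<forall>\<^sub>F x in inf (nhds a) (principal S). norm (D x) \<le> c * norm (g x)"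
    unfolding eventually_at_filter eventually_inf_principal
    by eventually_elim (use \<open>D a = 0\<close> c in fastforce)
qed

lemma transpose_mult_dot:
  fixes A :: "real^'d^'k"
  shows "v \<bullet> (transpose A *v y) = (A *v v) \<bullet> y"
  by (simp add: dot_lmul_matrix inner_commute[of _ y] inner_commute[of v])

text \<open>The vector A^T y combines the rows of \<open>A\<close> with the entries of
  \<open>y\<close> as coefficients, and each of the CARD('k) terms has norm at most
  \<open>norm y * norm A\<close>. A bound through \<open>norm A\<close> rather than an operator norm
  lets continuity of \<open>A\<close> enter directly.\<close>

lemma norm_transpose_mult_le:
  fixes A :: "real^'d^'k"
  shows "norm (transpose A *v y) \<le> real CARD('k) * norm A * norm y"
proof -
  have eq: "transpose A *v y = (\<Sum>i\<in>UNIV. y $ i *\<^sub>R A $ i)"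
    by (simp add: vec_eq_iff transpose_def matrix_vector_mult_def mult.commute del: transpose_matrix_vector)
  have "norm (transpose A *v y) \<le> (\<Sum>i\<in>UNIV. norm (y $ i *\<^sub>R A $ i))"
    unfolding eq by (rule norm_sum)
  also have "\<dots> \<le> (\<Sum>i\<in>(UNIV::'k set). norm y * norm A)"
    by (intro sum_mono) (auto intro!: mult_mono component_le_norm_cart Finite_Cartesian_Product.norm_nth_le)
  finally show ?thesis by (simp add: mult_ac)
qed

lemma in_L2_transpose_mult:
  fixes A :: "real^'d^'k"
  assumes "in_L2 M sc"
  shows "in_L2 M (\<lambda>x. transpose A *v sc x)"
  unfolding in_L2_iff
proof (rule square_integrable_bound[of M sc sc _ "real CARD('k) * norm A" 0])
  show "(\<lambda>x. transpose A *v sc x) \<in> borel_measurable M"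
    using assms unfolding in_L2_def
    by (intro borel_measurable_continuous_on[of "\<lambda>y. transpose A *v y" sc] linear_continuous_on
        matrix_vector_mul_bounded_linear) auto
  show "norm (transpose A *v sc x) \<le> real CARD('k) * norm A * norm (sc x) + 0 * norm (sc x)" for x
    using norm_transpose_mult_le[of A "sc x"] by simp
qed (use assms in \<open>simp_all add: in_L2_iff\<close>)

lemma has_densities_compose:
  assumes "has_densities M \<Theta> P \<mu> p" "f ` N \<subseteq> \<Theta>"
  shows "has_densities M N (\<lambda>\<nu>. P (f \<nu>)) \<mu> (\<lambda>\<nu>. p (f \<nu>))"
  using assms unfolding has_densities_def by blast

text \<open>With \<open>r\<close> the remainder of \<open>f\<close>, the remainder \<open>D'\<close>
  of the composed model is at most a constant times \<open>D (f \<nu>) + norm (r \<nu>) * R\<close>.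
  The first term is small relative to \<open>f \<nu> - f \<nu>0\<close>, which is of order
  \<open>\<nu> - \<nu>0\<close>; the second is small because \<open>f\<close> is differentiable and
  \<open>R\<close> does not depend on \<nu>.\<close>

lemma score_wrt_compose:
  fixes f :: "real^'d \<Rightarrow> real^'k" and A :: "real^'d^'k"
  assumes d: "has_densities M \<Theta> P \<mu> p" and sc: "score_wrt \<Theta> P \<mu> p (f \<nu>0) sc"
    and fN: "f ` N \<subseteq> \<Theta>" and nu: "\<nu>0 \<in> N"
    and f: "(f has_derivative (\<lambda>h. A *v h)) (at \<nu>0 within N)"
  shows "score_wrt N (\<lambda>\<nu>. P (f \<nu>)) \<mu> (\<lambda>\<nu>. p (f \<nu>)) \<nu>0 (\<lambda>x. transpose A *v sc x)"
proof -
  let ?F = "at \<nu>0 within N"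
  define D where "D = (\<lambda>\<theta>. L2_norm \<mu> (\<lambda>x. sqrt (p \<theta> x) - sqrt (p (f \<nu>0) x)
                          - 1 / 2 * ((\<theta> - f \<nu>0) \<bullet> sc x) * sqrt (p (f \<nu>0) x)))"
  define D' where "D' = (\<lambda>\<nu>. L2_norm \<mu> (\<lambda>x. sqrt (p (f \<nu>) x) - sqrt (p (f \<nu>0) x)
                          - 1 / 2 * ((\<nu> - \<nu>0) \<bullet> (transpose A *v sc x)) * sqrt (p (f \<nu>0) x)))"
  define r where "r = (\<lambda>\<nu>. f \<nu> - f \<nu>0 - A *v (\<nu> - \<nu>0))"
  define R where "R = L2_norm \<mu> (\<lambda>x. sqrt (p (f \<nu>0) x) *\<^sub>R sc x)"
  have th0: "f \<nu>0 \<in> \<Theta>" using fN nu by auto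
  have L2: "in_L2 (P (f \<nu>0)) sc" and Do: "D \<in> o[at (f \<nu>0) within \<Theta>](\<lambda>\<theta>. norm (\<theta> - f \<nu>0))"
    using sc by (auto simp: score_wrt_def D_def)
  have scm: "sc \<in> borel_measurable \<mu>"
    using L2 by (simp add: in_L2_def has_densitiesD(8)[OF d th0])
  have sq: "square_integrable \<mu> (\<lambda>x. sqrt (p (f \<nu>0) x) *\<^sub>R sc x)"
    using L2 square_integrable_density_iff[OF d th0 scm] by (simp add: in_L2_iff)
  have r: "(\<lambda>\<nu>. norm (r \<nu>)) \<in> o[?F](\<lambda>\<nu>. norm (\<nu> - \<nu>0))"
    using f unfolding has_derivative_iff_norm r_def
    by (intro smalloI_tendsto) (auto simp: eventually_at_filter)
  have bA: "(\<lambda>\<nu>. norm (A *v (\<nu> - \<nu>0))) \<in> O[?F](\<lambda>\<nu>. norm (\<nu> - \<nu>0))"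
  proof (rule landau_o.bigI)
    \<comment> \<open>The summand 1 keeps the constant strictly positive even when \<open>A\<close>
      is zero.\<close>
    show "\<forall>\<^sub>F \<nu> in ?F. norm (norm (A *v (\<nu> - \<nu>0))) \<le> (onorm ((*v) A) + 1) * norm (norm (\<nu> - \<nu>0))"
      using onorm[of "(*v) A"] by (intro always_eventually) (auto simp: distrib_right intro: add_increasing2)
    show "onorm ((*v) A) + 1 > 0"
      using onorm_pos_le[of "(*v) A"] by (simp add: matrix_vector_mul_bounded_linear)
  qed
  have fO: "(\<lambda>\<nu>. norm (f \<nu> - f \<nu>0)) \<in> O[?F](\<lambda>\<nu>. norm (\<nu> - \<nu>0))"
  proof (rule landau_o.big_trans[rotated])
    show "(\<lambda>\<nu>. norm (r \<nu>) + norm (A *v (\<nu> - \<nu>0))) \<in> O[?F](\<lambda>\<nu>. norm (\<nu> - \<nu>0))"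
      by (intro sum_in_bigo bA landau_o.small_imp_big r)
    have "norm (f \<nu> - f \<nu>0) \<le> norm (r \<nu>) + norm (A *v (\<nu> - \<nu>0))" for \<nu>
      using norm_triangle_ineq[of "r \<nu>" "A *v (\<nu> - \<nu>0)"] by (simp add: r_def)
    then show "(\<lambda>\<nu>. norm (f \<nu> - f \<nu>0)) \<in> O[?F](\<lambda>\<nu>. norm (r \<nu>) + norm (A *v (\<nu> - \<nu>0)))"
      by (intro landau_o.bigI[of 1] always_eventually) auto
  qed
  have flim: "filterlim f (inf (nhds (f \<nu>0)) (principal \<Theta>)) ?F"
    using has_derivative_continuous[OF f] fN
    by (auto simp: filterlim_inf filterlim_principal continuous_within eventually_at_filter image_subset_iff
        intro!: always_eventually)
  have "D \<in> o[inf (nhds (f \<nu>0)) (principal \<Theta>)](\<lambda>\<theta>. norm (\<theta> - f \<nu>0))"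
    by (rule smallo_at_within_extend[OF Do]) (simp add: D_def)
  then have "(\<lambda>\<nu>. D (f \<nu>)) \<in> o[?F](\<lambda>\<nu>. norm (f \<nu> - f \<nu>0))"
    by (rule landau_o.small.compose[OF _ flim])
  then have "(\<lambda>\<nu>. D (f \<nu>)) \<in> o[?F](\<lambda>\<nu>. norm (\<nu> - \<nu>0))"
    by (rule landau_o.small_big_trans[OF _ fO])
  then have bound_o: "(\<lambda>\<nu>. D (f \<nu>) + norm (r \<nu>) * R) \<in> o[?F](\<lambda>\<nu>. norm (\<nu> - \<nu>0))"
    using r by (intro sum_in_smallo) auto
  have *: "D' \<nu> \<le> 2 * (D (f \<nu>) + norm (r \<nu>) * R)" if "\<nu> \<in> N" for \<nu>
  proof -
    have th: "f \<nu> \<in> \<Theta>" using fN that by auto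
    have "D' \<nu> \<le> 2 * (1 * D (f \<nu>) + norm (r \<nu>) * R)"
      unfolding D_def D'_def R_def
    proof (rule L2_norm_le[OF square_integrable_remainder[OF d th th0 L2] sq])
      fix x assume x: "x \<in> space \<mu>"
      let ?q = "sqrt (p (f \<nu>0) x)"
      have "norm (1 / 2 * (r \<nu> \<bullet> sc x) * ?q) \<le> norm (r \<nu>) * norm (?q *\<^sub>R sc x)"
        using has_densitiesD(2)[OF d th0 x] by (intro norm_half_inner_mult_le) simp
      \<comment> \<open>Adjointness turns the increment into \<open>A *v (\<nu> - \<nu>0)\<close>,
        which is \<open>f \<nu> - f \<nu>0 - r \<nu>\<close>; the part with \<open>r \<nu>\<close>
        becomes the correction term.\<close>
      moreover have "sqrt (p (f \<nu>) x) - ?q - 1 / 2 * ((\<nu> - \<nu>0) \<bullet> (transpose A *v sc x)) * ?q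
        = (sqrt (p (f \<nu>) x) - ?q - 1 / 2 * ((f \<nu> - f \<nu>0) \<bullet> sc x) * ?q) + 1 / 2 * (r \<nu> \<bullet> sc x) * ?q"
        unfolding transpose_mult_dot by (simp add: r_def inner_diff_left algebra_simps)
      ultimately show "norm (sqrt (p (f \<nu>) x) - ?q - 1 / 2 * ((\<nu> - \<nu>0) \<bullet> (transpose A *v sc x)) * ?q)
        \<le> 1 * norm (sqrt (p (f \<nu>) x) - ?q - 1 / 2 * ((f \<nu> - f \<nu>0) \<bullet> sc x) * ?q)
          + norm (r \<nu>) * norm (?q *\<^sub>R sc x)"
        by (simp only: mult_1) (intro norm_triangle_mono order_refl)
    qed auto
    then show ?thesis by simp
  qed
  have "norm (D' \<nu>) \<le> 2 * norm (D (f \<nu>) + norm (r \<nu>) * R)" if "\<nu> \<in> N" for \<nu>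
  proof -
    have "norm (D' \<nu>) = D' \<nu>" by (simp add: D'_def L2_norm_nonneg)
    then show ?thesis using * [OF that] by simp
  qed
  then have "\<forall>\<^sub>F \<nu> in ?F. norm (D' \<nu>) \<le> 2 * norm (D (f \<nu>) + norm (r \<nu>) * R)"
    by (simp add: eventually_at_filter)
  then have "D' \<in> O[?F](\<lambda>\<nu>. D (f \<nu>) + norm (r \<nu>) * R)"
    by (rule bigoI)
  then have "D' \<in> o[?F](\<lambda>\<nu>. norm (\<nu> - \<nu>0))"
    by (rule landau_o.big_small_trans[OF _ bound_o])
  then show ?thesis
    unfolding score_wrt_def D'_def using in_L2_transpose_mult[OF L2] by blast
qed

section \<open>Fisher information\<close>

text \<open>A square matrix is invertible iff its kernel is trivial. The quadratic form of the
  information matrix at \<open>v\<close> is the integral of (v \<bullet> sc)^2, so \<open>v\<close>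
  lies in the kernel exactly when \<open>v \<bullet> sc x\<close> vanishes almost
  everywhere.\<close>

lemma invertible_fisher_information_iff:
  assumes sc: "in_L2 M sc"
  shows "invertible (fisher_information M sc) \<longleftrightarrow> (\<forall>v. (AE x in M. v \<bullet> sc x = 0) \<longrightarrow> v = 0)"
proof -
  let ?F = "fisher_information M sc"
  have m [measurable]: "sc \<in> borel_measurable M" and i: "integrable M (\<lambda>x. (norm (sc x))\<^sup>2)"
    using sc by (auto simp: in_L2_def)
  have cm [measurable]: "(\<lambda>x. sc x $ j) \<in> borel_measurable M" for j
    unfolding cart_eq_inner_axis by measurable
  have int: "integrable M (\<lambda>x. sc x $ i * sc x $ j)" for i j
    by (rule Bochner_Integration.integrable_bound[OF i])
       (auto intro!: AE_I2 mult_mono component_le_norm_cart simp: abs_mult power2_eq_square)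
  have Fv: "(?F *v v) $ i = (\<integral>x. sc x $ i * (v \<bullet> sc x) \<partial>M)" for v i
  proof -
    have "(\<integral>x. sc x $ i * (v \<bullet> sc x) \<partial>M) = (\<integral>x. (\<Sum>j\<in>UNIV. (sc x $ i * sc x $ j) * v $ j) \<partial>M)"
      by (simp add: inner_vec_def sum_distrib_left mult_ac)
    also have "\<dots> = (?F *v v) $ i"
      using int by (simp add: fisher_information_def matrix_vector_mult_def)
    finally show ?thesis by simp
  qed
  have int_v: "integrable M (\<lambda>x. sc x $ i * (v \<bullet> sc x))" for v i
    using int by (simp add: inner_vec_def sum_distrib_left mult.left_commute)
  \<comment> \<open>Only one of the two factors is expanded, so that integration yields the entries
    of \<open>?F *v v\<close>.\<close>
  have sq: "(v \<bullet> sc x)\<^sup>2 = (\<Sum>i\<in>UNIV. v $ i * (sc x $ i * (v \<bullet> sc x)))" for v x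
    by (simp add: power2_eq_square inner_vec_def[of v "sc x"] sum_distrib_right mult.assoc)
  have vFv: "v \<bullet> (?F *v v) = (\<integral>x. (v \<bullet> sc x)\<^sup>2 \<partial>M)" for v
    unfolding sq using int_v by (simp add: inner_vec_def[of v "?F *v v"] Fv)
  have int_v2: "integrable M (\<lambda>x. (v \<bullet> sc x)\<^sup>2)" for v
    unfolding sq using int_v by simp
  have "?F *v v = 0 \<longleftrightarrow> (AE x in M. v \<bullet> sc x = 0)" for v
  proof
    assume "?F *v v = 0"
    then have "(\<integral>x. (v \<bullet> sc x)\<^sup>2 \<partial>M) = 0" using vFv[of v] by simp
    then show "AE x in M. v \<bullet> sc x = 0"
      using integral_nonneg_eq_0_iff_AE[OF int_v2] by simp
  next
    assume ae: "AE x in M. v \<bullet> sc x = 0"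
    have "(\<integral>x. sc x $ i * (v \<bullet> sc x) \<partial>M) = 0" for i
      by (rule integral_eq_zero_AE) (use ae in eventually_elim, simp)
    then show "?F *v v = 0" by (simp add: vec_eq_iff Fv)
  qed
  then show ?thesis
    by (simp add: invertible_left_inverse matrix_left_invertible_ker)
qed

section \<open>Continuity of scores and regularity under reparametrization\<close>

text \<open>The difference of two products is split by changing one factor at a time: first
  \<open>z\<close> moves from \<open>f \<nu>0\<close> to \<open>f \<nu>\<close> under the matrix
  \<open>A \<nu>\<close>, which stays bounded near \<nu>0, then the matrix changes while
  \<open>z (f \<nu>0)\<close> is fixed.\<close>

lemma score_continuity_compose:
  fixes f :: "real^'d \<Rightarrow> real^'k" and A :: "real^'d \<Rightarrow> real^'d^'k"
  assumes d: "has_densities M \<Theta> P \<mu> p"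
    and L2: "\<And>\<theta>. \<theta> \<in> \<Theta> \<Longrightarrow> in_L2 (P \<theta>) (sc \<theta>)"
    and lim: "((\<lambda>\<theta>. L2_norm \<mu> (\<lambda>x. sqrt (p \<theta> x) *\<^sub>R sc \<theta> x - sqrt (p (f \<nu>0) x) *\<^sub>R sc (f \<nu>0) x))
                   \<longlongrightarrow> 0) (at (f \<nu>0) within \<Theta>)"
    and fN: "f ` N \<subseteq> \<Theta>" and nu: "\<nu>0 \<in> N"
    and f: "continuous (at \<nu>0 within N) f" and A: "continuous (at \<nu>0 within N) A"
  shows "((\<lambda>\<nu>. L2_norm \<mu> (\<lambda>x. sqrt (p (f \<nu>) x) *\<^sub>R (transpose (A \<nu>) *v sc (f \<nu>) x)
             - sqrt (p (f \<nu>0) x) *\<^sub>R (transpose (A \<nu>0) *v sc (f \<nu>0) x))) \<longlongrightarrow> 0) (at \<nu>0 within N)"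
proof -
  let ?K = "real CARD('k)"
  define z where "z = (\<lambda>\<theta> x. sqrt (p \<theta> x) *\<^sub>R sc \<theta> x)"
  define C where "C = (\<lambda>\<theta>. L2_norm \<mu> (\<lambda>x. z \<theta> x - z (f \<nu>0) x))"
  have th0: "f \<nu>0 \<in> \<Theta>" using fN nu by auto
  have zsq: "square_integrable \<mu> (z \<theta>)" if "\<theta> \<in> \<Theta>" for \<theta>
    using L2[OF that] square_integrable_density_iff[OF d that, of "sc \<theta>"]
    by (simp add: z_def in_L2_iff) (simp add: square_integrable_def has_densitiesD(8)[OF d that])
  have zd: "square_integrable \<mu> (\<lambda>x. z \<theta> x - z (f \<nu>0) x)" if "\<theta> \<in> \<Theta>" for \<theta>
  proof (rule square_integrable_bound[OF zsq[OF that] zsq[OF th0]])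
    show "(\<lambda>x. z \<theta> x - z (f \<nu>0) x) \<in> borel_measurable \<mu>"
      using zsq[OF that] zsq[OF th0] by (intro borel_measurable_diff) (simp_all add: square_integrable_def)
    show "norm (z \<theta> x - z (f \<nu>0) x) \<le> 1 * norm (z \<theta> x) + 1 * norm (z (f \<nu>0) x)" for x
      by (simp add: norm_triangle_ineq4)
  qed
  \<comment> \<open>The value 0 at the base point upgrades the punctured limit to continuity of
    \<open>C\<close>, which composes with \<open>f\<close> even if \<open>f\<close> returns to
    \<open>f \<nu>0\<close>.\<close>
  have C0: "C (f \<nu>0) = 0" by (simp add: C_def)
  have "continuous (at (f \<nu>0) within \<Theta>) C"
    using lim by (simp add: continuous_within C0) (simp add: C_def z_def)
  then have "continuous (at (f \<nu>0) within f ` N) C"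
    using fN by (rule continuous_within_subset)
  then have Cf: "((\<lambda>\<nu>. C (f \<nu>)) \<longlongrightarrow> 0) (at \<nu>0 within N)"
    using continuous_within_compose2[OF f, of C] by (simp add: continuous_within C0)
  have Alim: "(A \<longlongrightarrow> A \<nu>0) (at \<nu>0 within N)"
    using A by (simp add: continuous_within)
  let ?B = "\<lambda>\<nu>. 2 * ((?K * norm (A \<nu>)) * C (f \<nu>) + (?K * norm (A \<nu> - A \<nu>0)) * L2_norm \<mu> (z (f \<nu>0)))"
  have B0: "(?B \<longlongrightarrow> 0) (at \<nu>0 within N)"
  proof -
    have "(?B \<longlongrightarrow> 2 * ((?K * norm (A \<nu>0)) * 0
        + (?K * norm (A \<nu>0 - A \<nu>0)) * L2_norm \<mu> (z (f \<nu>0)))) (at \<nu>0 within N)"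
      by (intro tendsto_intros Cf Alim)
    then show ?thesis by simp
  qed
  have le: "L2_norm \<mu> (\<lambda>x. sqrt (p (f \<nu>) x) *\<^sub>R (transpose (A \<nu>) *v sc (f \<nu>) x)
             - sqrt (p (f \<nu>0) x) *\<^sub>R (transpose (A \<nu>0) *v sc (f \<nu>0) x)) \<le> ?B \<nu>" if "\<nu> \<in> N" for \<nu>
    unfolding C_def
  proof (rule L2_norm_le[OF zd zsq[OF th0]])
    show "f \<nu> \<in> \<Theta>" using fN that by auto
    fix x assume "x \<in> space \<mu>"
    have "sqrt (p (f \<nu>) x) *\<^sub>R (transpose (A \<nu>) *v sc (f \<nu>) x)
             - sqrt (p (f \<nu>0) x) *\<^sub>R (transpose (A \<nu>0) *v sc (f \<nu>0) x)
        = transpose (A \<nu>) *v (z (f \<nu>) x - z (f \<nu>0) x) + transpose (A \<nu> - A \<nu>0) *v z (f \<nu>0) x"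
      \<comment> \<open>Testing against every vector moves the transposes to the other side of the
        inner product, where ordinary distributivity applies.\<close>
      by (rule vector_eq_ldot[THEN iffD1], unfold inner_diff_right inner_add_right inner_scaleR_right transpose_mult_dot)
        (simp add: z_def matrix_vector_mult_diff_rdistrib inner_diff_left inner_diff_right algebra_simps)
    also have "norm \<dots> \<le> ?K * norm (A \<nu>) * norm (z (f \<nu>) x - z (f \<nu>0) x)
        + ?K * norm (A \<nu> - A \<nu>0) * norm (z (f \<nu>0) x)"
      by (rule norm_triangle_mono[OF norm_transpose_mult_le norm_transpose_mult_le])
    finally show "norm (sqrt (p (f \<nu>) x) *\<^sub>R (transpose (A \<nu>) *v sc (f \<nu>) x)
             - sqrt (p (f \<nu>0) x) *\<^sub>R (transpose (A \<nu>0) *v sc (f \<nu>0) x)) \<le> \<dots>" .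
  qed auto
  show ?thesis
    by (rule tendsto_sandwich[OF _ _ tendsto_const B0])
       (intro always_eventually allI L2_norm_nonneg, unfold eventually_at_filter, intro always_eventually allI impI le)
qed

lemma regular_parametric_model_compose:
  fixes f :: "real^'d \<Rightarrow> real^'k"
  assumes reg: "regular_parametric_model M \<Theta> P" and N: "open N" and fN: "f ` N \<subseteq> \<Theta>"
    and diff: "\<And>\<nu>. \<nu> \<in> N \<Longrightarrow> f differentiable (at \<nu>)"
    and cont: "continuous_on N (\<lambda>\<nu>. jacobian f (at \<nu>))"
    and rank: "\<And>\<nu>. \<nu> \<in> N \<Longrightarrow> rank (jacobian f (at \<nu>)) = CARD('d)"
  shows "regular_parametric_model M N (\<lambda>\<nu>. P (f \<nu>))"
proof -
  let ?J = "\<lambda>\<nu>. jacobian f (at \<nu>)"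
  obtain \<mu> p sc where d: "has_densities M \<Theta> P \<mu> p"
    and score: "\<And>\<theta>. \<theta> \<in> \<Theta> \<Longrightarrow> score_wrt \<Theta> P \<mu> p \<theta> (sc \<theta>)"
    and fisher: "\<And>\<theta>. \<theta> \<in> \<Theta> \<Longrightarrow> invertible (fisher_information (P \<theta>) (sc \<theta>))"
    and lim: "\<And>\<theta>0. \<theta>0 \<in> \<Theta> \<Longrightarrow> ((\<lambda>\<theta>. L2_norm \<mu> (\<lambda>x. sqrt (p \<theta> x) *\<^sub>R sc \<theta> x - sqrt (p \<theta>0 x) *\<^sub>R sc \<theta>0 x))
                   \<longlongrightarrow> 0) (at \<theta>0 within \<Theta>)"
    using reg unfolding regular_parametric_model_def by blast
  have L2: "in_L2 (P \<theta>) (sc \<theta>)" if "\<theta> \<in> \<Theta>" for \<theta>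
    using score[OF that] by (simp add: score_wrt_def)
  have th: "f \<nu> \<in> \<Theta>" if "\<nu> \<in> N" for \<nu> using fN that by auto
  have der: "(f has_derivative (\<lambda>h. ?J \<nu> *v h)) (at \<nu> within N)" if "\<nu> \<in> N" for \<nu>
    using diff[OF that] by (simp add: jacobian_works has_derivative_at_withinI)
  have inv: "invertible (fisher_information (P (f \<nu>)) (\<lambda>x. transpose (?J \<nu>) *v sc (f \<nu>) x))"
    if "\<nu> \<in> N" for \<nu>
    unfolding invertible_fisher_information_iff[OF in_L2_transpose_mult[OF L2[OF th[OF that]]]]
  proof (intro allI impI)
    \<comment> \<open>By adjointness the assumption says that \<open>?J \<nu> *v v\<close>
      annihilates the original score; nonsingularity of its information kills this vector, and full
      column rank then kills \<open>v\<close>.\<close>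
    fix v assume "AE x in P (f \<nu>). v \<bullet> (transpose (?J \<nu>) *v sc (f \<nu>) x) = 0"
    then have "?J \<nu> *v v = 0"
      using fisher[OF th[OF that]]
      by (simp only: invertible_fisher_information_iff[OF L2[OF th[OF that]]] transpose_mult_dot)
    moreover have "inj ((*v) (?J \<nu>))"
      using rank[OF that] by (simp add: full_rank_injective)
    ultimately show "v = 0"
      by (metis injD matrix_vector_mult_0_right)
  qed
  show ?thesis
    unfolding regular_parametric_model_def
  proof (intro conjI exI ballI)
    show "open N" by (rule N)
    show "has_densities M N (\<lambda>\<nu>. P (f \<nu>)) \<mu> (\<lambda>\<nu>. p (f \<nu>))"
      by (rule has_densities_compose[OF d fN])
    fix \<nu>0 assume nu: "\<nu>0 \<in> N"
    show "score_wrt N (\<lambda>\<nu>. P (f \<nu>)) \<mu> (\<lambda>\<nu>. p (f \<nu>)) \<nu>0 (\<lambda>x. transpose (?J \<nu>0) *v sc (f \<nu>0) x)"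
      by (rule score_wrt_compose[OF d score[OF th[OF nu]] fN nu der[OF nu]])
    show "invertible (fisher_information (P (f \<nu>0)) (\<lambda>x. transpose (?J \<nu>0) *v sc (f \<nu>0) x))"
      by (rule inv[OF nu])
    show "((\<lambda>\<nu>. L2_norm \<mu> (\<lambda>x. sqrt (p (f \<nu>) x) *\<^sub>R (transpose (?J \<nu>) *v sc (f \<nu>) x)
             - sqrt (p (f \<nu>0) x) *\<^sub>R (transpose (?J \<nu>0) *v sc (f \<nu>0) x))) \<longlongrightarrow> 0) (at \<nu>0 within N)"
      using cont nu
      by (intro score_continuity_compose[OF d L2 lim[OF th[OF nu]] fN nu
            has_derivative_continuous[OF der[OF nu]]])
         (auto simp: continuous_on_eq_continuous_within)
  qed
qed

section \<open>Uniqueness of the score across dominating measures\<close>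

text \<open>
  On the set where \<open>p \<theta>0\<close> is positive, the ratio \<open>p \<theta> / p \<theta>0\<close> is the density of the part of
  \<open>P \<theta>\<close> that is absolutely continuous with respect to \<open>P \<theta>0\<close>, and the complement of that set is
  a null set of \<open>P \<theta>0\<close>.
\<close>

lemma density_ratio_unique:
  assumes d1: "has_densities M \<Theta> P \<mu>1 p1" and d2: "has_densities M \<Theta> P \<mu>2 p2"
    and th: "\<theta> \<in> \<Theta>" "\<theta>0 \<in> \<Theta>"
  shows "AE x in P \<theta>0. p1 \<theta> x / p1 \<theta>0 x = p2 \<theta> x / p2 \<theta>0 x"
proof -
  interpret prob_space "P \<theta>0" by (rule has_densitiesD(4)[OF d1 th(2)])
  have pos: "AE x in P \<theta>0. 0 < p \<theta>0 x" if "has_densities M \<Theta> P \<mu> p" for \<mu> p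
    unfolding has_densitiesD(3)[OF that th(2)]
    using has_densitiesD(1)[OF that th(2)] by (subst AE_density) auto
  \<comment> \<open>On \<open>S\<close> neither quotient divides by zero, and \<open>S\<close> has
    full measure under \<open>P \<theta>0\<close>.\<close>
  define S where "S = {x \<in> space M. 0 < p1 \<theta>0 x \<and> 0 < p2 \<theta>0 x}"
  have m: "p \<theta>' \<in> borel_measurable M" if "has_densities M \<Theta> P \<mu> p" "\<theta>' \<in> \<Theta>" for \<mu> p \<theta>'
    using has_densitiesD(1)[OF that] has_densitiesD(6)[OF that] measurable_cong_sets by blast
  note [measurable] = m[OF d1 th(1)] m[OF d1 th(2)] m[OF d2 th(1)] m[OF d2 th(2)]
  have S [measurable]: "S \<in> sets M"
    unfolding S_def by measurable
  \<comment> \<open>The right-hand side mentions neither \<mu> nor \<open>p\<close>. Both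
    representations therefore give the same measure, and uniqueness of densities with respect to
    \<open>P \<theta>0\<close> identifies the ratios.\<close>
  have dens: "density (P \<theta>0) (\<lambda>x. ennreal (p \<theta> x / p \<theta>0 x) * indicator S x) = density (P \<theta>) (indicator S)"
    if d: "has_densities M \<Theta> P \<mu> p" and p: "\<And>x. x \<in> S \<Longrightarrow> 0 < p \<theta>0 x" for \<mu> p
  proof -
    note [measurable] = has_densitiesD(1)[OF d th(1)] has_densitiesD(1)[OF d th(2)]
    have [measurable]: "S \<in> sets \<mu>" using S has_densitiesD(6)[OF d th(2)] by simp
    have "density (P \<theta>0) (\<lambda>x. ennreal (p \<theta> x / p \<theta>0 x) * indicator S x)
        = density \<mu> (\<lambda>x. ennreal (p \<theta>0 x) * (ennreal (p \<theta> x / p \<theta>0 x) * indicator S x))"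
      unfolding has_densitiesD(3)[OF d th(2)] by (subst density_density_eq) auto
    also have "\<dots> = density \<mu> (\<lambda>x. ennreal (p \<theta> x) * indicator S x)"
    proof (rule density_cong)
      have "ennreal (p \<theta>0 x) * (ennreal (p \<theta> x / p \<theta>0 x) * indicator S x) = ennreal (p \<theta> x) * indicator S x"
        if "x \<in> space \<mu>" for x
        using p[of x] has_densitiesD(2)[OF d th(1) that]
        by (auto simp: indicator_def ennreal_mult[symmetric])
      then show "AE x in \<mu>. ennreal (p \<theta>0 x) * (ennreal (p \<theta> x / p \<theta>0 x) * indicator S x)
          = ennreal (p \<theta> x) * indicator S x" by (rule AE_I2)
    qed measurable
    also have "\<dots> = density (P \<theta>) (indicator S)"
      unfolding has_densitiesD(3)[OF d th(1)] by (subst density_density_eq) auto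
    finally show ?thesis .
  qed
  have mP: "g \<in> borel_measurable (P \<theta>0)" if "g \<in> borel_measurable M" for g :: "'a \<Rightarrow> ennreal"
    using that has_densitiesD(5)[OF d1 th(2)] measurable_cong_sets by blast
  have "AE x in P \<theta>0. ennreal (p1 \<theta> x / p1 \<theta>0 x) * indicator S x = ennreal (p2 \<theta> x / p2 \<theta>0 x) * indicator S x"
  proof (rule density_unique)
    show "density (P \<theta>0) (\<lambda>x. ennreal (p1 \<theta> x / p1 \<theta>0 x) * indicator S x)
        = density (P \<theta>0) (\<lambda>x. ennreal (p2 \<theta> x / p2 \<theta>0 x) * indicator S x)"
      using dens[OF d1] dens[OF d2] by (simp add: S_def)
  qed (intro mP; measurable)+
  with pos[OF d1] pos[OF d2] AE_space[of "P \<theta>0"] show ?thesis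
  proof eventually_elim
    case (elim x)
    moreover have "space (P \<theta>0) = space M" "space \<mu>1 = space M" "space \<mu>2 = space M"
      using has_densitiesD(5)[OF d1 th(2)] has_densitiesD(6)[OF d1 th(2)] has_densitiesD(6)[OF d2 th(2)]
      by (blast dest: sets_eq_imp_space_eq)+
    ultimately have x: "x \<in> space \<mu>1" "x \<in> space \<mu>2" "x \<in> S"
      by (simp_all add: S_def)
    then show ?case
      using elim has_densitiesD(2)[OF d1 th(1) x(1)] has_densitiesD(2)[OF d2 th(1) x(2)]
      by (simp add: ennreal_inj)
  qed
qed

text \<open>
  Dividing the expansion by \<open>sqrt (p \<theta>0 x)\<close> turns it into an expansion in \<open>L2(P(\<theta>0))\<close>; where
  \<open>p \<theta>0 x = 0\<close> the quotient has the junk value 0, but this is a null set of \<open>P \<theta>0\<close>.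
\<close>

lemma L2_norm_ratio_remainder:
  fixes h :: "real^'n"
  assumes d: "has_densities M \<Theta> P \<mu> p" and th: "\<theta> \<in> \<Theta>" "\<theta>0 \<in> \<Theta>"
    and sc: "in_L2 (P \<theta>0) sc"
  defines "g \<equiv> \<lambda>x. sqrt (p \<theta> x / p \<theta>0 x) - 1 - 1 / 2 * (h \<bullet> sc x)"
  shows "square_integrable (P \<theta>0) g"
    and "L2_norm (P \<theta>0) g \<le> 2 * L2_norm \<mu> (\<lambda>x. sqrt (p \<theta> x) - sqrt (p \<theta>0 x)
                          - 1 / 2 * (h \<bullet> sc x) * sqrt (p \<theta>0 x))"
proof -
  note [measurable] = has_densitiesD(1)[OF d th(1)] has_densitiesD(1)[OF d th(2)]
  have [measurable]: "sc \<in> borel_measurable \<mu>"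
    using sc by (simp add: in_L2_def has_densitiesD(8)[OF d th(2)])
  have gm [measurable]: "g \<in> borel_measurable \<mu>"
    unfolding g_def by measurable
  let ?u = "\<lambda>x. sqrt (p \<theta> x) - sqrt (p \<theta>0 x) - 1 / 2 * (h \<bullet> sc x) * sqrt (p \<theta>0 x)"
  note u = square_integrable_remainder[OF d th sc, of h]
  \<comment> \<open>Equality holds where \<open>p \<theta>0 x\<close> is positive. Where it is 0 the
    left side vanishes, while \<open>?u x\<close> may still see mass of \<open>P \<theta>\<close>.
    The term with coefficient 0 only fits the two-term shape of the bounds.\<close>
  have le: "norm (sqrt (p \<theta>0 x) *\<^sub>R g x) \<le> 1 * norm (?u x) + 0 * norm (?u x)" if "x \<in> space \<mu>" for x
  proof (cases "p \<theta>0 x = 0")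
    case False
    then have "sqrt (p \<theta>0 x) > 0" using has_densitiesD(2)[OF d th(2) that] by simp
    then have "sqrt (p \<theta>0 x) *\<^sub>R g x = ?u x"
      by (simp add: g_def real_sqrt_divide field_simps)
    then show ?thesis by simp
  qed simp
  show "square_integrable (P \<theta>0) g"
    unfolding square_integrable_density_iff[OF d th(2) gm]
    by (rule square_integrable_bound[OF u u _ le]) measurable
  show "L2_norm (P \<theta>0) g \<le> 2 * L2_norm \<mu> ?u"
    unfolding L2_norm_density[OF d th(2) gm]
    using L2_norm_le[OF u u le] by simp
qed

lemma L2_norm_scaleR: "L2_norm M (\<lambda>x. c *\<^sub>R g x) = \<bar>c\<bar> * L2_norm M g"
  by (simp add: L2_norm_def power_mult_distrib real_sqrt_mult)

lemma L2_norm_cong_AE: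
  assumes "g \<in> borel_measurable M" "h \<in> borel_measurable M" "AE x in M. g x = h x"
  shows "L2_norm M g = L2_norm M h"
  unfolding L2_norm_def using assms
  by (intro arg_cong[of _ _ sqrt] integral_cong_AE) (auto elim!: eventually_mono)

text \<open>Openness of \<Theta> makes every direction at \<theta>0 available for the homogeneity
  argument; without it the expansion would constrain the scores only along directions that \<Theta>
  offers.\<close>

lemma score_wrt_unique:
  fixes s1 s2 :: "'a \<Rightarrow> real^'n"
  assumes S: "open \<Theta>" "\<theta>0 \<in> \<Theta>"
    and d1: "has_densities M \<Theta> P \<mu>1 p1" and d2: "has_densities M \<Theta> P \<mu>2 p2"
    and s1: "score_wrt \<Theta> P \<mu>1 p1 \<theta>0 s1" and s2: "score_wrt \<Theta> P \<mu>2 p2 \<theta>0 s2"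
  shows "AE x in P \<theta>0. s1 x = s2 x"
proof -
  define D where "D = (\<lambda>\<mu> (p :: real^'n \<Rightarrow> 'a \<Rightarrow> real) (s :: 'a \<Rightarrow> real^'n) \<theta>. L2_norm \<mu> (\<lambda>x. sqrt (p \<theta> x) - sqrt (p \<theta>0 x)
                          - 1 / 2 * ((\<theta> - \<theta>0) \<bullet> s x) * sqrt (p \<theta>0 x)))"
  let ?d = "\<lambda>x. s1 x - s2 x"
  have F: "at \<theta>0 within \<Theta> = at \<theta>0"
    using S by (rule at_within_open[rotated])
  have L1: "in_L2 (P \<theta>0) s1" and o1: "D \<mu>1 p1 s1 \<in> o[at \<theta>0](\<lambda>\<theta>. norm (\<theta> - \<theta>0))"
    and L2: "in_L2 (P \<theta>0) s2" and o2: "D \<mu>2 p2 s2 \<in> o[at \<theta>0](\<lambda>\<theta>. norm (\<theta> - \<theta>0))"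
    using s1 s2 by (simp_all add: score_wrt_def D_def F)
  have [measurable]: "s1 \<in> borel_measurable (P \<theta>0)" "s2 \<in> borel_measurable (P \<theta>0)"
    using L1 L2 by (auto simp: in_L2_def)
  \<comment> \<open>Subtracting the two expansions cancels the common ratio. The constant 8 collects
    three factors 2: from the 1/2 in the expansion, from \<open>L2_norm_le\<close>, and from
    \<open>L2_norm_ratio_remainder\<close>.\<close>
  have bound: "L2_norm (P \<theta>0) (\<lambda>x. (\<theta> - \<theta>0) \<bullet> ?d x) \<le> 8 * (D \<mu>1 p1 s1 \<theta> + D \<mu>2 p2 s2 \<theta>)"
    if th: "\<theta> \<in> \<Theta>" for \<theta>
  proof -
    define h where "h = \<theta> - \<theta>0"
    let ?g = "\<lambda>p s x. sqrt (p \<theta> x / p \<theta>0 x) - 1 - 1 / 2 * (h \<bullet> s x)"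
    note r1 = L2_norm_ratio_remainder[OF d1 th S(2) L1, of h]
    note r2 = L2_norm_ratio_remainder[OF d2 th S(2) L2, of h]
    have ae: "AE x in P \<theta>0. 1 / 2 * (h \<bullet> ?d x) = ?g p2 s2 x - ?g p1 s1 x"
      using density_ratio_unique[OF d1 d2 th S(2)]
      by eventually_elim (simp add: inner_diff_right algebra_simps)
    have m: "?g p1 s1 \<in> borel_measurable (P \<theta>0)" "?g p2 s2 \<in> borel_measurable (P \<theta>0)"
      using r1(1) r2(1) by (auto simp: square_integrable_def)
    have "1 / 2 * L2_norm (P \<theta>0) (\<lambda>x. h \<bullet> ?d x) = L2_norm (P \<theta>0) (\<lambda>x. 1 / 2 * (h \<bullet> ?d x))"
      using L2_norm_scaleR[of "P \<theta>0" "1 / 2" "\<lambda>x. h \<bullet> ?d x"] by simp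
    also have "\<dots> = L2_norm (P \<theta>0) (\<lambda>x. ?g p2 s2 x - ?g p1 s1 x)"
      by (rule L2_norm_cong_AE[OF _ borel_measurable_diff[OF m(2,1)] ae]) measurable
    also have "\<dots> \<le> 2 * (1 * L2_norm (P \<theta>0) (?g p2 s2) + 1 * L2_norm (P \<theta>0) (?g p1 s1))"
      by (rule L2_norm_le[OF r2(1) r1(1)]) (auto simp only: mult_1 norm_triangle_ineq4 zero_le_one)
    also have "\<dots> \<le> 2 * (2 * D \<mu>2 p2 s2 \<theta> + 2 * D \<mu>1 p1 s1 \<theta>)"
      using r1(2) r2(2) by (simp add: D_def h_def)
    finally show ?thesis by (simp add: h_def)
  qed
  have "(\<lambda>\<theta>. D \<mu>1 p1 s1 \<theta> + D \<mu>2 p2 s2 \<theta>) \<in> o[at \<theta>0](\<lambda>\<theta>. norm (\<theta> - \<theta>0))"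
    using o1 o2 by (rule sum_in_smallo)
  note small = landau_o.smallD[OF this]
  have zero: "L2_norm (P \<theta>0) (\<lambda>x. b \<bullet> ?d x) = 0" if b: "norm b = 1" for b
  proof -
    have "L2_norm (P \<theta>0) (\<lambda>x. b \<bullet> ?d x) \<le> 8 * c" if c: "c > 0" for c
    proof -
      have "\<forall>\<^sub>F \<theta> in at \<theta>0. \<theta> \<in> \<Theta>"
        using S by (simp add: eventually_at_in_open')
      with small[OF c] have "\<forall>\<^sub>F \<theta> in at \<theta>0. L2_norm (P \<theta>0) (\<lambda>x. (\<theta> - \<theta>0) \<bullet> ?d x) \<le> 8 * c * norm (\<theta> - \<theta>0)"
        by eventually_elim (use bound in force)
      then obtain e where e: "e > 0" and le: "\<And>\<theta>. \<theta> \<noteq> \<theta>0 \<Longrightarrow> dist \<theta> \<theta>0 < e \<Longrightarrow>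
          L2_norm (P \<theta>0) (\<lambda>x. (\<theta> - \<theta>0) \<bullet> ?d x) \<le> 8 * c * norm (\<theta> - \<theta>0)"
        unfolding eventually_at by auto
      \<comment> \<open>The test point \<open>\<theta>0 + (e / 2) *\<^sub>R b\<close> differs from
        \<theta>0 and lies within distance \<open>e\<close>. The step length \<open>e / 2\<close>
        cancels by homogeneity, leaving a bound with arbitrary \<open>c\<close>.\<close>
      have "b \<noteq> 0" using b by auto
      then have "L2_norm (P \<theta>0) (\<lambda>x. (e / 2) *\<^sub>R (b \<bullet> ?d x)) \<le> 8 * c * (e / 2)"
        using le[of "\<theta>0 + (e / 2) *\<^sub>R b"] e b by (auto simp: dist_norm)
      then show ?thesis
        unfolding L2_norm_scaleR using e by (simp add: field_simps)
    qed
    from this[of "e / 8" for e]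
    have "L2_norm (P \<theta>0) (\<lambda>x. b \<bullet> ?d x) \<le> 0 + e" if "e > 0" for e
      using that by simp
    then have "L2_norm (P \<theta>0) (\<lambda>x. b \<bullet> ?d x) \<le> 0"
      by (rule field_le_epsilon)
    then show ?thesis
      using L2_norm_nonneg[of "P \<theta>0" "\<lambda>x. b \<bullet> ?d x"] by simp
  qed
  have sq: "square_integrable (P \<theta>0) ?d"
    using L1 L2 norm_triangle_ineq4
    by (intro square_integrable_bound[of "P \<theta>0" s1 s2 ?d 1 1]) (simp_all add: in_L2_iff)
  have "AE x in P \<theta>0. b \<bullet> ?d x = 0" if b: "b \<in> Basis" for b
  proof -
    \<comment> \<open>A vanishing \<open>L2_norm\<close> forces the function to vanish almost
      everywhere only if its square is integrable, since the Bochner integral is 0 by default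
      otherwise.\<close>
    have "square_integrable (P \<theta>0) (\<lambda>x. b \<bullet> ?d x)"
    proof (rule square_integrable_bound[OF sq sq])
      show "norm (b \<bullet> ?d x) \<le> 1 * norm (?d x) + 0 * norm (?d x)" for x
        using Basis_le_norm[OF b, of "?d x"] by (simp add: inner_commute)
    qed measurable
    then show ?thesis
      using zero[of b] b
      by (simp add: L2_norm_def square_integrable_def integral_nonneg_eq_0_iff_AE)
  qed
  then have "AE x in P \<theta>0. \<forall>b\<in>Basis. b \<bullet> ?d x = 0"
    by (intro AE_finite_allI) auto
  then show ?thesis
  proof eventually_elim
    case (elim x)
    then have "?d x = 0" by (metis euclidean_all_zero_iff inner_commute)
    then show ?case by simp
  qed
qed

section \<open>The induced submodel and its score\<close>

theorem proposition2p1: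
  fixes M :: "'a measure"
    and \<Theta> :: "(real^'k) set" and N :: "(real^'d) set" and \<G> :: "'g set"
    and P :: "real^'k \<Rightarrow> 'g \<Rightarrow> 'a measure"
    and f :: "real^'d \<Rightarrow> real^'k" and \<psi> :: "real^'k \<Rightarrow> 'g"
    and \<nu>0 :: "real^'d" and \<theta>0 :: "real^'k" and G0 :: 'g
    and scP :: "'a \<Rightarrow> real^'k"
  assumes "open \<Theta>" and "open N" and "CARD('d) < CARD('k)"
    and "regular_semiparametric_model M \<Theta> \<G> P"
    and "f ` N \<subseteq> \<Theta>"
    and "\<forall>\<nu>\<in>N. f differentiable (at \<nu>)"
    and "continuous_on N (\<lambda>\<nu>. jacobian f (at \<nu>))"
    and "\<forall>\<nu>\<in>N. rank (jacobian f (at \<nu>)) = CARD('d)"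
    and "regular_semiparametric_model M N \<G> (\<lambda>\<nu>. P (f \<nu>))"
    and "\<nu>0 \<in> N" and "\<theta>0 = f \<nu>0" and "G0 \<in> \<G>"
    and "regular_parametric_submodel M \<Theta> \<G> P \<psi>" and "\<psi> \<theta>0 = G0"
    and "score_function M \<Theta> (\<lambda>\<theta>. P \<theta> (\<psi> \<theta>)) \<theta>0 scP"
  shows "regular_parametric_submodel M N \<G> (\<lambda>\<nu>. P (f \<nu>)) (\<lambda>\<nu>. \<psi> (f \<nu>)) \<and>
    score_function M N (\<lambda>\<nu>. P (f \<nu>) (\<psi> (f \<nu>))) \<nu>0
      (\<lambda>x. transpose (jacobian f (at \<nu>0)) *v scP x) \<and>
    (\<forall>scQ. score_function M N (\<lambda>\<nu>. P (f \<nu>) (\<psi> (f \<nu>))) \<nu>0 scQ \<longrightarrow>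
       (AE x in P \<theta>0 G0. scQ x = transpose (jacobian f (at \<nu>0)) *v scP x))"
proof (intro conjI allI impI)
  let ?Q = "\<lambda>\<nu>. P (f \<nu>) (\<psi> (f \<nu>))"
  let ?s = "\<lambda>x. transpose (jacobian f (at \<nu>0)) *v scP x"
  have reg: "regular_parametric_model M \<Theta> (\<lambda>\<theta>. P \<theta> (\<psi> \<theta>))" and psi: "\<psi> ` \<Theta> \<subseteq> \<G>"
    using assms(13) by (auto simp: regular_parametric_submodel_def)
  have "regular_parametric_model M N ?Q"
    using assms(2,5-8) by (intro regular_parametric_model_compose[OF reg]) auto
  then show "regular_parametric_submodel M N \<G> (\<lambda>\<nu>. P (f \<nu>)) (\<lambda>\<nu>. \<psi> (f \<nu>))"
    using psi assms(5) by (auto simp: regular_parametric_submodel_def)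
  \<comment> \<open>The dominating measure and densities that certify \<open>scP\<close> may differ
    from those behind \<open>reg\<close>, so the chain rule is applied afresh to \<open>scP\<close>
    itself.\<close>
  obtain \<mu> p where d: "has_densities M \<Theta> (\<lambda>\<theta>. P \<theta> (\<psi> \<theta>)) \<mu> p"
    and sc: "score_wrt \<Theta> (\<lambda>\<theta>. P \<theta> (\<psi> \<theta>)) \<mu> p (f \<nu>0) scP"
    using assms(11,15) by (auto simp: score_function_def)
  have der: "(f has_derivative (\<lambda>h. jacobian f (at \<nu>0) *v h)) (at \<nu>0 within N)"
    using assms(6,10) by (simp add: jacobian_works has_derivative_at_withinI)
  note dQ = has_densities_compose[OF d assms(5)]
  note sQ = score_wrt_compose[OF d sc assms(5,10) der]
  show "score_function M N ?Q \<nu>0 ?s"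
    unfolding score_function_def using dQ sQ by blast
  fix scQ assume "score_function M N ?Q \<nu>0 scQ"
  then obtain \<mu>' p' where "has_densities M N ?Q \<mu>' p'" "score_wrt N ?Q \<mu>' p' \<nu>0 scQ"
    unfolding score_function_def by blast
  \<comment> \<open>\<open>scQ\<close> comes with its own dominating measure, which is why
    uniqueness has to hold across two of them.\<close>
  from score_wrt_unique[OF assms(2,10) this(1) dQ this(2) sQ]
  show "AE x in P \<theta>0 G0. scQ x = ?s x"
    using assms(14) unfolding assms(11) by auto
qed

end
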